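(* Let $(S,+,\ell)$ be an adequate partial layered semigroup with $\delta$ layers and let $\mathcal F$ be a locally finite collection of regressive maps on $S$. Suppose $S$ is $\mathcal F$-Ramsey, and let $n<\delta$. Then for any finite colouring of $S$ there exists a block sequence $(x_i)_{i=1}^\infty\subseteq S_n$ such that for every $k\le n$ the set $$S_k\cap\big\{f_1(x_{n_1})+\cdots+f_\ell(x_{n_\ell}):\ 1\le n_1<\cdots<n_\ell,\ f_1,\dots,f_\ell\in\mathcal F\big\}$$ is monochromatic.
   Context: Nonstandard framework: a universe with a star map $M\mapsto{}^*M$ (iterable: ${}^{*k}M$) satisfying the usual properties (${}^*A\supseteq\{{}^*x:x\in A\}$ for sets, monotonicity, ${}^*(A^k)=({}^*A)^k$, functions extend to their stars, ${}^*s=s$ for $s\in S$, ${}^*n=n$ for $n\in\mathbb N$) and the transfer principle for bounded-quantifier formulas; the nonstandard universe is assumed saturated enough that ${}^*S$ is compact in the topology generated by the sets ${}^*B$, $B\subseteq S$. Extensions of $+$ and of maps $f$ are denoted by the same symbols. For $\alpha\in{}^{*m}S$ let $\mathcal U_\alpha=\{B\subseteq S:\alpha\in{}^{*m}B\}$; $\alpha\sim\beta$ ($u$-equivalent) iff $\mathcal U_\alpha=\mathcal U_\beta$. Write $\alpha\preccurlyeq\beta$ iff $\alpha+{}^*\beta\sim\beta+{}^*\alpha\sim\alpha$. Layered semigroups: an adequate partial layered semigroup is a partial semigroup $(S,+)$ with a map $\ell:S\to\mathbb N$ whose range is an initial segment of $\mathbb N$ of size $\delta\in\mathbb N\cup\{\omega\}$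 (the number of layers), with layers $S_i=\ell^{-1}(i)$ and $S_{\le i}=\ell^{-1}(\{0,\dots,i\})$, such that $\ell(s+t)=\max\{\ell(s),\ell(t)\}$ whenever $s+t$ is defined, and for all $s_1,\dots,s_n$ in a common layer $S_i$ there is $t\in S_i$ with $s_j+t$ defined for all $j$ (total semigroups are a special case). For $B\subseteq S$, ${}^\gamma B=\{\alpha\in{}^*B: x+\alpha$ defined for all $x\in B\}$, and $\Pi_S=\prod_{i<\delta}{}^\gamma S_i$. A regressive map is $f:S\to S$ with: $f(s+t)=f(s)+f(t)$ (homomorphism); $\ell(f(s))\le\ell(s)$; $\ell(s)\le\ell(t)\Rightarrow\ell(f(s))\le\ell(f(t))$; $|\ell(f(s))-\ell(f(t))|\le|\ell(s)-\ell(t)|$. A collection $\mathcal F$ of regressive maps is locally finite if for each $i$ the set $\{f|_{S_{\le i}}:f\in\mathcal F\}$ is finite. An element $(\alpha_i)_{i<\delta}\in\Pi_S$ is $\mathcal F$-coherent if for all $f\in\mathcal F$ and $j<\delta$ there is $k\le j$ with $f(\alpha_j)\sim\alpha_k$; it is $\mathcal F$-Ramsey if it is $\mathcal F$-coherent and $\alpha_j\preccurlyeq\alpha_i$ for all $i\le j<\delta$ (so in particular each $\alpha_i$ satisfies $\alpha_i+{}^*\alpha_i\sim\alpha_i$). $S$ is $\mathcal F$-Ramsey if $\Pi_S$ contains an $\mathcal F$-Ramsey element. A sequence $(x_i)$ in $S$ is a block sequence if for all indices $n_0<\cdots<n_{\ell-1}$ and $f_0,\dots,f_{\ell-1}\in\mathcal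 F$ the sum $f_0(x_{n_0})+\cdots+f_{\ell-1}(x_{n_{\ell-1}})$ is defined. *)

theory Defs
  imports "HOL-Analysis.Analysis" "HOL-Library.Extended_Nat"
begin

section \<open>Adequate partial layered semigroups\<close>

text \<open>A partial operation on a carrier \<open>S\<close> is a function into an option type: \<open>padd x y = None\<close>
  means that \<open>x + y\<close> is undefined. Values outside the carrier are irrelevant. Associativity is read
  in the strong sense: if either side is defined, then so is the other, and they agree.\<close>

definition partial_semigroup :: "'a set \<Rightarrow> ('a \<Rightarrow> 'a \<Rightarrow> 'a option) \<Rightarrow> bool" where
  "partial_semigroup S padd \<longleftrightarrow>
     (\<forall>x\<in>S. \<forall>y\<in>S. \<forall>z. padd x y = Some z \<longrightarrow> z \<in> S) \<and>
     (\<forall>x\<in>S. \<forall>y\<in>S. \<forall>z\<in>S.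
        Option.bind (padd x y) (\<lambda>u. padd u z) = Option.bind (padd y z) (\<lambda>v. padd x v))"

definition layer :: "'a set \<Rightarrow> ('a \<Rightarrow> nat) \<Rightarrow> nat \<Rightarrow> 'a set" where
  "layer S l i = {s \<in> S. l s = i}"

definition layers_upto :: "'a set \<Rightarrow> ('a \<Rightarrow> nat) \<Rightarrow> nat \<Rightarrow> 'a set" where
  "layers_upto S l i = {s \<in> S. l s \<le> i}"

definition layered_semigroup ::
  "'a set \<Rightarrow> ('a \<Rightarrow> 'a \<Rightarrow> 'a option) \<Rightarrow> ('a \<Rightarrow> nat) \<Rightarrow> enat \<Rightarrow> bool" where
  "layered_semigroup S padd l \<delta> \<longleftrightarrow>
     partial_semigroup S padd \<and>
     l ` S = {i. enat i < \<delta>} \<and>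
     (\<forall>s\<in>S. \<forall>t\<in>S. \<forall>u. padd s t = Some u \<longrightarrow> l u = max (l s) (l t))"

definition adequate :: "'a set \<Rightarrow> ('a \<Rightarrow> 'a \<Rightarrow> 'a option) \<Rightarrow> ('a \<Rightarrow> nat) \<Rightarrow> bool" where
  "adequate S padd l \<longleftrightarrow>
     (\<forall>i T. finite T \<and> T \<noteq> {} \<and> T \<subseteq> layer S l i \<longrightarrow>
        (\<exists>t \<in> layer S l i. \<forall>s\<in>T. padd s t \<noteq> None))"

text \<open>The homomorphism condition is read as: whenever \<open>s + t\<close> is defined, so is \<open>f s + f t\<close>, and
  \<open>f (s + t) = f s + f t\<close>.\<close>

definition regressive ::
  "'a set \<Rightarrow> ('a \<Rightarrow> 'a \<Rightarrow> 'a option) \<Rightarrow> ('a \<Rightarrow> nat) \<Rightarrow> ('a \<Rightarrow> 'a) \<Rightarrow> bool" where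
  "regressive S padd l f \<longleftrightarrow>
     f \<in> S \<rightarrow> S \<and>
     (\<forall>s\<in>S. \<forall>t\<in>S. \<forall>u. padd s t = Some u \<longrightarrow> padd (f s) (f t) = Some (f u)) \<and>
     (\<forall>s\<in>S. l (f s) \<le> l s) \<and>
     (\<forall>s\<in>S. \<forall>t\<in>S. l s \<le> l t \<longrightarrow> l (f s) \<le> l (f t)) \<and>
     (\<forall>s\<in>S. \<forall>t\<in>S. \<bar>int (l (f s)) - int (l (f t))\<bar> \<le> \<bar>int (l s) - int (l t)\<bar>)"

definition locally_finite_maps :: "'a set \<Rightarrow> ('a \<Rightarrow> nat) \<Rightarrow> ('a \<Rightarrow> 'a) set \<Rightarrow> bool" where
  "locally_finite_maps S l F \<longleftrightarrow>
     (\<forall>i. finite ((\<lambda>f. restrict f (layers_upto S l i)) ` F))"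

text \<open>The sum of a list; by associativity the bracketing does not matter. The empty sum is
  left undefined and never used.\<close>

fun psum :: "('a \<Rightarrow> 'a \<Rightarrow> 'a option) \<Rightarrow> 'a list \<Rightarrow> 'a option" where
  "psum padd [] = None"
| "psum padd [x] = Some x"
| "psum padd (x # y # zs) = Option.bind (psum padd (y # zs)) (padd x)"

text \<open>The (possibly undefined) sums \<open>f\<^sub>1(x\<^bsub>n\<^sub>1\<^esub>) + \<dots> + f\<^sub>r(x\<^bsub>n\<^sub>r\<^esub>)\<close> with \<open>r \<ge> 1\<close>,
  \<open>n\<^sub>1 < \<dots> < n\<^sub>r\<close> and \<open>f\<^sub>1, \<dots>, f\<^sub>r \<in> F\<close>.\<close>

definition sums_along ::
  "('a \<Rightarrow> 'a \<Rightarrow> 'a option) \<Rightarrow> ('a \<Rightarrow> 'a) set \<Rightarrow> (nat \<Rightarrow> 'a) \<Rightarrow> 'a option set" where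
  "sums_along padd F x =
     {psum padd (map2 (\<lambda>f n. f (x n)) fs ns) | fs ns.
        ns \<noteq> [] \<and> sorted_wrt (<) ns \<and> length fs = length ns \<and> set fs \<subseteq> F}"

definition block_sequence ::
  "('a \<Rightarrow> 'a \<Rightarrow> 'a option) \<Rightarrow> ('a \<Rightarrow> 'a) set \<Rightarrow> (nat \<Rightarrow> 'a) \<Rightarrow> bool" where
  "block_sequence padd F x \<longleftrightarrow> None \<notin> sums_along padd F x"


section \<open>Universes\<close>

text \<open>A universe is a collection \<open>'v\<close> of atoms and sets, with \<open>ext a\<close> the set of members of \<open>a\<close>.
  It is automatically transitive, and is closed under the listed operations and under arbitrary
  subsets; superstructures and all other usual notions of universe are instances. Power sets are
  not required.\<close>

locale set_universe =
  fixes is_set :: "'v \<Rightarrow> bool" and ext :: "'v \<Rightarrow> 'v set"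
begin

text \<open>The HOL sets that are sets of the universe.\<close>

definition small :: "'v set \<Rightarrow> bool" where
  "small A \<longleftrightarrow> (\<exists>a. is_set a \<and> ext a = A)"

definition set_of :: "'v set \<Rightarrow> 'v" where
  "set_of A = (THE a. is_set a \<and> ext a = A)"

definition opair :: "'v \<Rightarrow> 'v \<Rightarrow> 'v" where
  "opair x y = set_of {set_of {x}, set_of {x, y}}"

definition fun_graph :: "'v set \<Rightarrow> ('v \<Rightarrow> 'v) \<Rightarrow> 'v set" where
  "fun_graph A f = {opair x (f x) | x. x \<in> A}"

definition op_graph :: "'v set \<Rightarrow> ('v \<Rightarrow> 'v \<Rightarrow> 'v option) \<Rightarrow> 'v set" where
  "op_graph A padd = {opair (opair x y) z | x y z. x \<in> A \<and> y \<in> A \<and> padd x y = Some z}"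

end

text \<open>Bounded-quantifier formulas of set theory with atoms, with named variables.\<close>

datatype bfm =
    Eq nat nat
  | Mem nat nat
  | IsSet nat
  | Neg bfm
  | Conj bfm bfm
  | BEx nat nat bfm  \<comment> \<open>\<open>BEx i j \<phi>\<close> is \<open>\<exists>x\<^sub>i \<in> x\<^sub>j. \<phi>\<close>\<close>

primrec sat :: "('v \<Rightarrow> bool) \<Rightarrow> ('v \<Rightarrow> 'v set) \<Rightarrow> bfm \<Rightarrow> (nat \<Rightarrow> 'v) \<Rightarrow> bool" where
  "sat is_set ext (Eq i j) e \<longleftrightarrow> e i = e j"
| "sat is_set ext (Mem i j) e \<longleftrightarrow> e i \<in> ext (e j)"
| "sat is_set ext (IsSet i) e \<longleftrightarrow> is_set (e i)"
| "sat is_set ext (Neg \<phi>) e \<longleftrightarrow> \<not> sat is_set ext \<phi> e"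
| "sat is_set ext (Conj \<phi> \<psi>) e \<longleftrightarrow> sat is_set ext \<phi> e \<and> sat is_set ext \<psi> e"
| "sat is_set ext (BEx i j \<phi>) e \<longleftrightarrow> (\<exists>u \<in> ext (e j). sat is_set ext \<phi> (e(i := u)))"

text \<open>The star map goes from the universe to itself, so it can be iterated. The elementary
  properties of the star map (monotonicity, compatibility with products, extension of functions)
  are consequences of transfer. The last assumption provides a copy of the natural numbers
  consisting of fixed points.\<close>

locale star_universe = set_universe is_set ext
  for is_set :: "'v \<Rightarrow> bool" and ext :: "'v \<Rightarrow> 'v set" +
  fixes star :: "'v \<Rightarrow> 'v"
  assumes atom_empty: "\<not> is_set a \<Longrightarrow> ext a = {}"
    and extensionality: "is_set a \<Longrightarrow> is_set b \<Longrightarrow> ext a = ext b \<Longrightarrow> a = b"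
    and small_subset: "small A \<Longrightarrow> B \<subseteq> A \<Longrightarrow> small B"
    and small_pair: "small {x, y}"
    and small_Union: "small A \<Longrightarrow> small (\<Union>a\<in>A. ext a)"
    and small_times: "small A \<Longrightarrow> small B \<Longrightarrow> small {opair x y | x y. x \<in> A \<and> y \<in> B}"
    and transfer: "sat is_set ext \<phi> (\<lambda>i. star (e i)) \<longleftrightarrow> sat is_set ext \<phi> e"
    and star_nat: "\<exists>num :: nat \<Rightarrow> 'v. inj num \<and> small (range num) \<and> (\<forall>n. star (num n) = num n)"
begin

text \<open>\<open>hyp m A\<close> is the set of elements of the \<open>m\<close>-fold star of \<open>A\<close>.\<close>

definition hyp :: "nat \<Rightarrow> 'v set \<Rightarrow> 'v set" where
  "hyp m A = ext ((star ^^ m) (set_of A))"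

end

text \<open>The semigroup \<open>S\<close> lives inside the universe. The last assumption is the saturation
  assumption.\<close>

locale nonstandard_universe = star_universe is_set ext star
  for is_set :: "'v \<Rightarrow> bool" and ext :: "'v \<Rightarrow> 'v set" and star :: "'v \<Rightarrow> 'v" +
  fixes S :: "'v set"
  assumes small_S: "small S"
    and star_S: "s \<in> S \<Longrightarrow> star s = s"
    and compact_star_S: "compact_space (topology_generated_by {hyp 1 B | B. B \<subseteq> S})"
begin

definition ufilter :: "nat \<Rightarrow> 'v \<Rightarrow> 'v set set" where
  "ufilter m \<alpha> = {B. B \<subseteq> S \<and> \<alpha> \<in> hyp m B}"

text \<open>\<open>u_equiv m \<alpha> m' \<beta>\<close> is \<open>u\<close>-equivalence of \<open>\<alpha>\<close> in the \<open>m\<close>-fold and \<open>\<beta>\<close> in the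
  \<open>m'\<close>-fold star of \<open>S\<close>.\<close>

definition u_equiv :: "nat \<Rightarrow> 'v \<Rightarrow> nat \<Rightarrow> 'v \<Rightarrow> bool" where
  "u_equiv m \<alpha> m' \<beta> \<longleftrightarrow> \<alpha> \<in> hyp m S \<and> \<beta> \<in> hyp m' S \<and> ufilter m \<alpha> = ufilter m' \<beta>"

text \<open>The extensions of a partial operation and of a map on \<open>S\<close> to the \<open>m\<close>-fold star of \<open>S\<close>.\<close>

definition hplus :: "nat \<Rightarrow> ('v \<Rightarrow> 'v \<Rightarrow> 'v option) \<Rightarrow> 'v \<Rightarrow> 'v \<Rightarrow> 'v option" where
  "hplus m padd \<alpha> \<beta> =
     (if \<exists>\<gamma>. opair (opair \<alpha> \<beta>) \<gamma> \<in> hyp m (op_graph S padd)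
      then Some (THE \<gamma>. opair (opair \<alpha> \<beta>) \<gamma> \<in> hyp m (op_graph S padd)) else None)"

definition hfun :: "nat \<Rightarrow> ('v \<Rightarrow> 'v) \<Rightarrow> 'v \<Rightarrow> 'v" where
  "hfun m f \<alpha> = (THE \<beta>. opair \<alpha> \<beta> \<in> hyp m (fun_graph S f))"

text \<open>\<open>\<alpha> \<preceq> \<beta>\<close> for \<open>\<alpha>\<close>, \<open>\<beta>\<close> in the star of \<open>S\<close>; both sums, which live in the twofold star
  of \<open>S\<close>, are required to be defined.\<close>

definition preceq :: "('v \<Rightarrow> 'v \<Rightarrow> 'v option) \<Rightarrow> 'v \<Rightarrow> 'v \<Rightarrow> bool" where
  "preceq padd \<alpha> \<beta> \<longleftrightarrow>
     (\<exists>\<sigma> \<tau>. hplus 2 padd \<alpha> (star \<beta>) = Some \<sigma> \<and> hplus 2 padd \<beta> (star \<alpha>) = Some \<tau> \<and>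
        u_equiv 2 \<sigma> 2 \<tau> \<and> u_equiv 2 \<tau> 1 \<alpha>)"

definition gamma :: "('v \<Rightarrow> 'v \<Rightarrow> 'v option) \<Rightarrow> 'v set \<Rightarrow> 'v set" where
  "gamma padd B = {\<alpha> \<in> hyp 1 B. \<forall>x\<in>B. hplus 1 padd x \<alpha> \<noteq> None}"

definition layer_product ::
  "('v \<Rightarrow> 'v \<Rightarrow> 'v option) \<Rightarrow> ('v \<Rightarrow> nat) \<Rightarrow> enat \<Rightarrow> (nat \<Rightarrow> 'v) set" where
  "layer_product padd l \<delta> = (\<Pi>\<^sub>E i\<in>{i. enat i < \<delta>}. gamma padd (layer S l i))"

definition coherent :: "('v \<Rightarrow> 'v) set \<Rightarrow> enat \<Rightarrow> (nat \<Rightarrow> 'v) \<Rightarrow> bool" where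
  "coherent F \<delta> \<alpha> \<longleftrightarrow>
     (\<forall>f\<in>F. \<forall>j. enat j < \<delta> \<longrightarrow> (\<exists>k\<le>j. u_equiv 1 (hfun 1 f (\<alpha> j)) 1 (\<alpha> k)))"

definition Ramsey_element ::
  "('v \<Rightarrow> 'v \<Rightarrow> 'v option) \<Rightarrow> ('v \<Rightarrow> 'v) set \<Rightarrow> enat \<Rightarrow> (nat \<Rightarrow> 'v) \<Rightarrow> bool" where
  "Ramsey_element padd F \<delta> \<alpha> \<longleftrightarrow>
     coherent F \<delta> \<alpha> \<and> (\<forall>i j. i \<le> j \<and> enat j < \<delta> \<longrightarrow> preceq padd (\<alpha> j) (\<alpha> i))"

definition Ramsey ::
  "('v \<Rightarrow> 'v \<Rightarrow> 'v option) \<Rightarrow> ('v \<Rightarrow> nat) \<Rightarrow> enat \<Rightarrow> ('v \<Rightarrow> 'v) set \<Rightarrow> bool" where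
  "Ramsey padd l \<delta> F \<longleftrightarrow> (\<exists>\<alpha> \<in> layer_product padd l \<delta>. Ramsey_element padd F \<delta> \<alpha>)"

end

end

theory Submission
  imports Defs
begin

text \<open>Let \<open>\<U>\<^sub>i\<close> be the ultrafilter generated by the \<open>i\<close>-th entry of a Ramsey element. By transfer,
  \<open>\<U>\<^sub>i \<oplus> \<U>\<^sub>j = \<U>\<^bsub>max i j\<^esub>\<close>, and every \<open>f \<in> F\<close> pushes \<open>\<U>\<^sub>n\<close> forward to some \<open>\<U>\<^sub>k\<close> with \<open>k \<le> n\<close>.
  Choose in each layer \<open>k \<le> n\<close> a colour class \<open>A\<^sub>k \<in> \<U>\<^sub>k\<close>, and let \<open>A\<^sub>k\<^sup>*\<close> consist of the \<open>s \<in> A\<^sub>k\<close>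
  such that \<open>s + y \<in> A\<^bsub>max k j\<^esub>\<close> for \<open>\<U>\<^sub>j\<close>-almost all \<open>y\<close>, for every \<open>j \<le> n\<close>. As in the
  Galvin--Glazer proof of Hindman's theorem, \<open>A\<^sub>k\<^sup>* \<in> \<U>\<^sub>k\<close>, and for \<open>s \<in> A\<^sub>k\<^sup>*\<close> even
  \<open>s + y \<in> A\<^sup>*\<^bsub>max k j\<^esub>\<close> for \<open>\<U>\<^sub>j\<close>-almost all \<open>y\<close>. Hence the sequence can be chosen recursively
  with all sums in the sets \<open>A\<^sub>k\<^sup>*\<close>; each step imposes only finitely many conditions, because \<open>F\<close>
  is finite on the layer \<open>n\<close>.\<close>

section \<open>Ultrafilters and sums\<close>

definition ultrafilter_on :: "'a set \<Rightarrow> 'a set set \<Rightarrow> bool" where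
  "ultrafilter_on S U \<longleftrightarrow> {} \<notin> U \<and> (\<forall>A. A \<subseteq> S \<longrightarrow> A \<in> U \<or> S - A \<in> U) \<and>
     (\<forall>A\<in>U. \<forall>B. A \<subseteq> B \<and> B \<subseteq> S \<longrightarrow> B \<in> U) \<and> (\<forall>A\<in>U. \<forall>B\<in>U. A \<inter> B \<in> U)"

lemma ultrafilter_on_mono:
  "ultrafilter_on S U \<Longrightarrow> A \<in> U \<Longrightarrow> A \<subseteq> B \<Longrightarrow> B \<subseteq> S \<Longrightarrow> B \<in> U"
  unfolding ultrafilter_on_def by blast

lemma ultrafilter_on_Int:
  "ultrafilter_on S U \<Longrightarrow> A \<in> U \<Longrightarrow> B \<in> U \<Longrightarrow> A \<inter> B \<in> U"
  unfolding ultrafilter_on_def by blast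

lemma ultrafilter_on_Diff:
  "ultrafilter_on S U \<Longrightarrow> A \<subseteq> S \<Longrightarrow> A \<notin> U \<Longrightarrow> S - A \<in> U"
  unfolding ultrafilter_on_def by blast

lemma ultrafilter_on_space: "ultrafilter_on S U \<Longrightarrow> S \<in> U"
  unfolding ultrafilter_on_def by (metis Diff_cancel order_refl)

text \<open>The factor \<open>S\<close> serves the empty family, whose \<open>\<Inter>\<close> is
  the whole type.\<close>

lemma ultrafilter_on_Inter:
  assumes "ultrafilter_on S U" "finite \<A>" "\<A> \<subseteq> U"
  shows "S \<inter> \<Inter>\<A> \<in> U"
  using assms(2,3)
proof (induction \<A> rule: finite_induct)
  case empty
  then show ?case using ultrafilter_on_space[OF assms(1)] by simp
next
  case (insert A \<A>)
  then have "A \<inter> (S \<inter> \<Inter>\<A>) \<in> U" using ultrafilter_on_Int[OF assms(1), of A] by simp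
  then show ?case by (simp only: Inter_insert Int_left_commute)
qed

text \<open>Otherwise \<open>U\<close> contains the complements of all colour classes of
  \<open>L\<close>. There are finitely many of them, and no point of \<open>L\<close> lies in
  all.\<close>

lemma ultrafilter_on_monochromatic:
  assumes U: "ultrafilter_on S U" and L: "L \<in> U" and LS: "L \<subseteq> S" and c: "finite (c ` S)"
  obtains col where "{s \<in> L. c s = col} \<in> U"
proof (rule ccontr)
  assume no: "\<not> thesis"
  have "S - {s \<in> L. c s = col} \<in> U" for col
    using no that LS by (intro ultrafilter_on_Diff[OF U]) auto
  then have "S \<inter> \<Inter>((\<lambda>col. S - {s \<in> L. c s = col}) ` (c ` S)) \<in> U"
    using c by (intro ultrafilter_on_Inter[OF U]) auto
  then have "L \<inter> (S \<inter> \<Inter>((\<lambda>col. S - {s \<in> L. c s = col}) ` (c ` S))) \<in> U"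
    by (rule ultrafilter_on_Int[OF U L])
  moreover have "L \<inter> (S \<inter> \<Inter>((\<lambda>col. S - {s \<in> L. c s = col}) ` (c ` S))) = {}"
    using LS by auto
  ultimately show False using U unfolding ultrafilter_on_def by simp
qed

section \<open>Partial sums, shifts and the recursive choice of a sequence\<close>

lemma partial_semigroup_closed:
  "partial_semigroup S padd \<Longrightarrow> x \<in> S \<Longrightarrow> y \<in> S \<Longrightarrow> padd x y = Some z \<Longrightarrow> z \<in> S"
  unfolding partial_semigroup_def by blast

lemma partial_semigroup_assoc:
  "partial_semigroup S padd \<Longrightarrow> x \<in> S \<Longrightarrow> y \<in> S \<Longrightarrow> z \<in> S \<Longrightarrow>
     Option.bind (padd x y) (\<lambda>u. padd u z) = Option.bind (padd y z) (padd x)"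
  unfolding partial_semigroup_def by blast

text \<open>\<open>psum\<close> splits off the first summand, whereas the sequence is built by
  adding new terms on the right. Strong associativity moves the bracket, also when a sum is
  undefined.\<close>

lemma psum_snoc:
  assumes ps: "partial_semigroup S padd" and "xs \<noteq> []" "set xs \<subseteq> S" "y \<in> S"
  shows "psum padd (xs @ [y]) = Option.bind (psum padd xs) (\<lambda>s. padd s y)"
proof -
  have closed: "psum padd zs = Some s \<Longrightarrow> set zs \<subseteq> S \<Longrightarrow> s \<in> S" for zs s
  proof (induction zs arbitrary: s rule: induct_list012)
    case (3 x y zs)
    then obtain u where "psum padd (y # zs) = Some u" "padd x u = Some s"
      by (auto simp: Option.bind_eq_Some_conv)
    then show ?case
      using 3 partial_semigroup_closed[OF ps, of x u s] by simp
  qed auto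
  show ?thesis
    using assms(2,3)
  proof (induction xs rule: list_nonempty_induct)
    case (single x)
    then show ?case by simp
  next
    case (cons x xs)
    obtain z zs where xs: "xs = z # zs" using cons.hyps by (cases xs) auto
    have "psum padd ((x # xs) @ [y]) = Option.bind (psum padd (xs @ [y])) (padd x)"
      by (simp add: xs)
    also have "\<dots> = Option.bind (psum padd xs) (\<lambda>s. Option.bind (padd s y) (padd x))"
      using cons by simp
    also have "\<dots> = Option.bind (psum padd xs) (\<lambda>s. Option.bind (padd x s) (\<lambda>u. padd u y))"
    proof (rule Option.bind_cong[OF refl])
      fix s assume "psum padd xs = Some s"
      then have "s \<in> S" using closed cons.prems by simp
      then show "Option.bind (padd s y) (padd x) = Option.bind (padd x s) (\<lambda>u. padd u y)"
        using partial_semigroup_assoc[OF ps, of x s y] cons.prems assms(4) by simp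
    qed
    also have "\<dots> = Option.bind (psum padd (x # xs)) (\<lambda>s. padd s y)"
      by (simp add: xs)
    finally show ?case .
  qed
qed

text \<open>This is the set -s + B of the ultrafilter proof of Hindman's theorem. Definedness of the
  sum is part of membership, so ultrafilter statements about shifts also yield defined sums.\<close>

definition shift ::
  "'a set \<Rightarrow> ('a \<Rightarrow> 'a \<Rightarrow> 'a option) \<Rightarrow> 'a \<Rightarrow> 'a set \<Rightarrow> 'a set" where
  "shift S padd s B = {y \<in> S. \<exists>z\<in>B. padd s y = Some z}"

lemma shift_subset: "shift S padd s B \<subseteq> S"
  unfolding shift_def by blast

lemma shift_shift:
  assumes "partial_semigroup S padd" "s \<in> S" "y \<in> S" "padd s y = Some z"
  shows "shift S padd y (shift S padd s B) \<subseteq> shift S padd z B"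
proof
  fix w assume w: "w \<in> shift S padd y (shift S padd s B)"
  then obtain v u where "w \<in> S" "padd y w = Some v" "u \<in> B" "padd s v = Some u"
    unfolding shift_def by blast
  then show "w \<in> shift S padd z B"
    using partial_semigroup_assoc[OF assms(1-3) \<open>w \<in> S\<close>] assms(4) unfolding shift_def by auto
qed

text \<open>The recursion behind the sequence, free of ultrafilters. \<open>F\<close> may be
  infinite, but it takes only finitely many values at each point of \<open>L\<close>, so only
  finitely many sums exist at each stage and \<open>ex\<close> applies again.\<close>

lemma sums_along_choice:
  assumes ps: "partial_semigroup S padd" and FS: "\<And>f. f \<in> F \<Longrightarrow> f \<in> S \<rightarrow> S"
    and LS: "L \<subseteq> S" and fin: "finite ((\<lambda>f. restrict f L) ` F)"
    and ex: "\<And>G. finite G \<Longrightarrow> G \<subseteq> T \<Longrightarrow>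
      \<exists>x\<in>L. \<forall>f\<in>F. f x \<in> T \<and> (\<forall>s\<in>G. \<exists>z\<in>T. padd s (f x) = Some z)"
  obtains x :: "nat \<Rightarrow> 'a" where "range x \<subseteq> L" "sums_along padd F x \<subseteq> Some ` T"
proof -
  define good where "good G x \<longleftrightarrow>
    x \<in> L \<and> (\<forall>f\<in>F. f x \<in> T \<and> (\<forall>s\<in>G. \<exists>z\<in>T. padd s (f x) = Some z))" for G x
  define pick where "pick G = (SOME x. good G x)" for G
  \<comment> \<open>\<open>G m\<close> will hold all sums with indices below \<open>m\<close>. The
    values of \<open>the\<close> are genuine sums because \<open>good\<close> makes them
    defined.\<close>
  define next_set where "next_set G = G \<union> (\<lambda>f. f (pick G)) ` F \<union>
    (\<lambda>(s, y). the (padd s y)) ` (G \<times> (\<lambda>f. f (pick G)) ` F)" for G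
  define G where "G m = (next_set ^^ m) {}" for m
  define x where "x m = pick (G m)" for m
  have pick: "good H (pick H)" if "finite H" "H \<subseteq> T" for H
    unfolding pick_def using ex[OF that] by (metis (mono_tags) good_def someI_ex)
  have finF: "finite ((\<lambda>f. f y) ` F)" if "y \<in> L" for y
  proof -
    have "(\<lambda>f. f y) ` F = (\<lambda>g. g y) ` ((\<lambda>f. restrict f L) ` F)"
      using that by (auto simp: image_image)
    then show ?thesis using fin by simp
  qed
  have G: "finite (G m) \<and> G m \<subseteq> T" for m
  proof (induction m)
    case 0
    then show ?case by (simp add: G_def)
  next
    case (Suc m)
    then have g: "good (G m) (pick (G m))" using pick by blast
    then have "finite ((\<lambda>f. f (pick (G m))) ` F)" using finF by (simp add: good_def)
    moreover have "G (Suc m) = next_set (G m)" by (simp add: G_def)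
    moreover have "the (padd s (f (pick (G m)))) \<in> T" if "s \<in> G m" "f \<in> F" for s f
      using g that unfolding good_def by (metis option.sel)
    moreover have "f (pick (G m)) \<in> T" if "f \<in> F" for f
      using g that unfolding good_def by blast
    ultimately show ?case using Suc by (auto simp: next_set_def)
  qed
  have good: "good (G m) (x m)" for m using G pick x_def by simp
  have xL: "x m \<in> L" for m using good unfolding good_def by blast
  have GSuc: "G (Suc m) = G m \<union> (\<lambda>f. f (x m)) ` F \<union>
    (\<lambda>(s, y). the (padd s y)) ` (G m \<times> (\<lambda>f. f (x m)) ` F)" for m
    by (simp add: G_def next_set_def x_def)
  have mono: "G m \<subseteq> G k" if "m \<le> k" for m k
    using that by (induction rule: dec_induct) (auto simp: GSuc)
  \<comment> \<open>The successor appears because the values at \<open>x m\<close> enter only in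
    \<open>G (Suc m)\<close>.\<close>
  have sums: "\<exists>s\<in>G (Suc (last ns)). psum padd (map2 (\<lambda>f n. f (x n)) fs ns) = Some s"
    if "ns \<noteq> []" "sorted_wrt (<) ns" "length fs = length ns" "set fs \<subseteq> F" for fs ns
    using that
  proof (induction ns arbitrary: fs rule: rev_induct)
    case Nil
    then show ?case by simp
  next
    case (snoc k ns)
    obtain gs f where fs: "fs = gs @ [f]" using snoc.prems(3) by (cases fs rule: rev_cases) auto
    then have len: "length gs = length ns" and f: "f \<in> F" and gs: "set gs \<subseteq> F"
      using snoc.prems by auto
    show ?case
    proof (cases "ns = []")
      case True
      then show ?thesis using f len by (auto simp: fs GSuc)
    next
      case False
      obtain s where s: "s \<in> G (Suc (last ns))"
        "psum padd (map2 (\<lambda>f n. f (x n)) gs ns) = Some s"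
        using snoc.IH[OF False _ len gs] snoc.prems by (auto simp: sorted_wrt_append)
      \<comment> \<open>The sum over the earlier indices is thus already in \<open>G k\<close> when
        \<open>x k\<close> is chosen, and \<open>good\<close> covers it.\<close>
      have "Suc (last ns) \<le> k" using snoc.prems False by (simp add: sorted_wrt_append Suc_leI)
      then have sG: "s \<in> G k" using s mono by blast
      obtain z where z: "padd s (f (x k)) = Some z"
        using good[of k] sG f unfolding good_def by blast
      have "set (map2 (\<lambda>f n. f (x n)) gs ns) \<subseteq> S"
        using gs FS xL LS by (auto dest!: set_zip_leftD) blast
      moreover have "map2 (\<lambda>f n. f (x n)) gs ns \<noteq> []" using False len by auto
      moreover have "f (x k) \<in> S" using FS[OF f] xL LS by blast
      ultimately have "psum padd (map2 (\<lambda>f n. f (x n)) gs ns @ [f (x k)]) = Some z"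
        by (simp add: psum_snoc[OF ps] s z)
      moreover have "z \<in> G (Suc k)"
        unfolding GSuc using sG f z by (intro UnI2 image_eqI[of _ _ "(s, f (x k))"]) auto
      ultimately show ?thesis by (simp add: fs len)
    qed
  qed
  show thesis
  proof
    show "range x \<subseteq> L" using xL by blast
    show "sums_along padd F x \<subseteq> Some ` T"
    proof
      fix r assume "r \<in> sums_along padd F x"
      then obtain fs ns where r: "r = psum padd (map2 (\<lambda>f n. f (x n)) fs ns)"
        and "ns \<noteq> []" "sorted_wrt (<) ns" "length fs = length ns" "set fs \<subseteq> F"
        unfolding sums_along_def by blast
      with sums[of ns fs] G[of "Suc (last ns)"] show "r \<in> Some ` T" by auto
    qed
  qed
qed

section \<open>The Galvin--Glazer argument for a family of ultrafilters indexed by layers\<close>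

lemma ultrafilter_sums_monochromatic:
  fixes U :: "nat \<Rightarrow> 'a set set"
  assumes ps: "partial_semigroup S padd" and FS: "\<And>f. f \<in> F \<Longrightarrow> f \<in> S \<rightarrow> S"
    and fin: "finite ((\<lambda>f. restrict f (layer S l n)) ` F)"
    and U: "\<And>k. k \<le> n \<Longrightarrow> ultrafilter_on S (U k)"
    and L: "\<And>k. k \<le> n \<Longrightarrow> layer S l k \<in> U k"
    and add: "\<And>i j B. i \<le> n \<Longrightarrow> j \<le> n \<Longrightarrow> B \<subseteq> S \<Longrightarrow> B \<in> U (max i j) \<Longrightarrow>
      {x \<in> S. shift S padd x B \<in> U j} \<in> U i"
    and coh: "\<And>f. f \<in> F \<Longrightarrow> \<exists>k\<le>n. \<forall>B\<in>U k. B \<subseteq> S \<longrightarrow> {s \<in> S. f s \<in> B} \<in> U n"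
    and c: "finite (c ` S)"
  shows "\<exists>x :: nat \<Rightarrow> 'a. range x \<subseteq> layer S l n \<and> block_sequence padd F x \<and>
           (\<forall>k\<le>n. \<exists>col. \<forall>s \<in> layer S l k. Some s \<in> sums_along padd F x \<longrightarrow> c s = col)"
proof -
  have "\<exists>col. {s \<in> layer S l k. c s = col} \<in> U k" if "k \<le> n" for k
    by (rule ultrafilter_on_monochromatic[OF U[OF that] L[OF that] _ c]) (auto simp: layer_def)
  then obtain col where col: "\<And>k. k \<le> n \<Longrightarrow> {s \<in> layer S l k. c s = col k} \<in> U k"
    by metis
  define A where "A k = {s \<in> layer S l k. c s = col k}" for k
  have AS: "A k \<subseteq> S" for k unfolding A_def layer_def by blast
  \<comment> \<open>These are the starred sets of the overview. The bound on \<open>j\<close> leaves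
    finitely many conditions, each of which \<open>add\<close> verifies for almost all
    \<open>s\<close>.\<close>
  define A' where "A' k = {s \<in> A k. \<forall>j\<le>n. shift S padd s (A (max k j)) \<in> U j}" for k
  have A'S: "A' k \<subseteq> S" for k unfolding A'_def using AS by blast
  have A': "A' k \<in> U k" if k: "k \<le> n" for k
  proof -
    have "S \<inter> \<Inter>((\<lambda>j. {x \<in> S. shift S padd x (A (max k j)) \<in> U j}) ` {..n}) \<in> U k"
      using k col AS by (intro ultrafilter_on_Inter[OF U]) (auto intro!: add simp: A_def)
    then have "A k \<inter> (S \<inter> \<Inter>((\<lambda>j. {x \<in> S. shift S padd x (A (max k j)) \<in> U j}) ` {..n})) \<in> U k"
      using ultrafilter_on_Int[OF U[OF k] col[OF k]] unfolding A_def by blast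
    moreover have "A k \<inter> (S \<inter> \<Inter>((\<lambda>j. {x \<in> S. shift S padd x (A (max k j)) \<in> U j}) ` {..n})) = A' k"
      using AS[of k] by (auto simp: A'_def)
    ultimately show ?thesis by simp
  qed
  have shift_A': "shift S padd s (A' (max k j)) \<in> U j"
    if s: "s \<in> A' k" and k: "k \<le> n" and j: "j \<le> n" for s k j
  proof -
    \<comment> \<open>Membership of \<open>y\<close> in \<open>?Q i\<close> says that s + (y + w)
      lies in the required colour class for almost all \<open>w\<close>. Since
      \<open>s \<in> A' k\<close>, the inner shift is in \<open>U (max j i)\<close>, so
      \<open>add\<close> makes \<open>?Q i\<close> large.\<close>
    let ?Q = "\<lambda>i. {y \<in> S. shift S padd y (shift S padd s (A (max k (max j i)))) \<in> U i}"
    have "?Q i \<in> U j" if "i \<le> n" for i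
      using s j that by (intro add[OF j that shift_subset]) (auto simp: A'_def)
    then have "S \<inter> \<Inter>(?Q ` {..n}) \<in> U j"
      by (intro ultrafilter_on_Inter[OF U[OF j]]) auto
    moreover have "shift S padd s (A (max k j)) \<in> U j"
      using s j by (simp add: A'_def)
    ultimately have "shift S padd s (A (max k j)) \<inter> (S \<inter> \<Inter>(?Q ` {..n})) \<in> U j"
      using ultrafilter_on_Int[OF U[OF j]] by blast
    moreover have "shift S padd s (A (max k j)) \<inter> (S \<inter> \<Inter>(?Q ` {..n}))
        \<subseteq> shift S padd s (A' (max k j))"
    proof
      fix y assume y: "y \<in> shift S padd s (A (max k j)) \<inter> (S \<inter> \<Inter>(?Q ` {..n}))"
      then obtain z where z: "z \<in> A (max k j)" "padd s y = Some z" "y \<in> S"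
        unfolding shift_def by blast
      \<comment> \<open>With z = s + y, reassociating s + (y + w) as z + w transfers the condition
        in \<open>?Q i\<close> to \<open>z\<close>; the layers agree by associativity of
        \<open>max\<close>.\<close>
      have "shift S padd z (A (max (max k j) i)) \<in> U i" if i: "i \<le> n" for i
      proof (rule ultrafilter_on_mono[OF U[OF i]])
        show "shift S padd y (shift S padd s (A (max k (max j i)))) \<in> U i"
          using y i by blast
        show "shift S padd y (shift S padd s (A (max k (max j i))))
            \<subseteq> shift S padd z (A (max (max k j) i))"
          using shift_shift[OF ps _ z(3,2)] s A'S by (auto simp: max.assoc)
      qed (rule shift_subset)
      then show "y \<in> shift S padd s (A' (max k j))"
        using z unfolding shift_def A'_def by auto
    qed
    ultimately show ?thesis
      by (intro ultrafilter_on_mono[OF U[OF j] _ _ shift_subset]) auto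
  qed
  \<comment> \<open>The layers are merged because the values f(x), and sums of them, may fall in any
    layer up to \<open>n\<close>.\<close>
  define T where "T = (\<Union>k\<le>n. A' k)"
  have ex: "\<exists>x\<in>layer S l n. \<forall>f\<in>F. f x \<in> T \<and> (\<forall>s\<in>G. \<exists>z\<in>T. padd s (f x) = Some z)"
    if G: "finite G" "G \<subseteq> T" for G
  proof -
    define E where "E f = {x \<in> layer S l n. f x \<in> T \<and> (\<forall>s\<in>G. \<exists>z\<in>T. padd s (f x) = Some z)}" for f
    have "E f \<in> U n" if f: "f \<in> F" for f
    proof -
      \<comment> \<open>\<open>f\<close> sends \<open>U n\<close> to \<open>U k\<close>, so the
        conditions on f(x) need only hold almost everywhere for \<open>U k\<close>.\<close>
      obtain k where k: "k \<le> n" and kf: "\<And>B. B \<in> U k \<Longrightarrow> B \<subseteq> S \<Longrightarrow> {s \<in> S. f s \<in> B} \<in> U n"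
        using coh[OF f] by blast
      have "shift S padd s T \<in> U k" if "s \<in> G" for s
      proof -
        obtain i where i: "i \<le> n" "s \<in> A' i" using \<open>s \<in> G\<close> G by (auto simp: T_def)
        have "A' (max i k) \<subseteq> T" unfolding T_def by (rule UN_upper) (use i k in simp)
        then have "shift S padd s (A' (max i k)) \<subseteq> shift S padd s T" by (auto simp: shift_def)
        then show ?thesis
          using shift_A'[OF i(2,1) k] by (intro ultrafilter_on_mono[OF U[OF k] _ _ shift_subset])
      qed
      then have "S \<inter> \<Inter>((\<lambda>s. shift S padd s T) ` G) \<in> U k"
        using G by (intro ultrafilter_on_Inter[OF U[OF k]]) auto
      then have "A' k \<inter> (S \<inter> \<Inter>((\<lambda>s. shift S padd s T) ` G)) \<in> U k"
        by (rule ultrafilter_on_Int[OF U[OF k] A'[OF k]])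
      from kf[OF this] have "{s \<in> S. f s \<in> A' k \<inter> (S \<inter> \<Inter>((\<lambda>s. shift S padd s T) ` G))} \<in> U n"
        using A'S by blast
      then have "layer S l n \<inter> {s \<in> S. f s \<in> A' k \<inter> (S \<inter> \<Inter>((\<lambda>s. shift S padd s T) ` G))} \<in> U n"
        by (rule ultrafilter_on_Int[OF U[OF order_refl] L[OF order_refl]])
      then show ?thesis
        by (rule ultrafilter_on_mono[OF U[OF order_refl]])
          (use k in \<open>auto simp: E_def T_def shift_def layer_def\<close>)
    qed
    \<comment> \<open>\<open>E f\<close> depends only on \<open>f\<close> restricted to layer
      \<open>n\<close>, so local finiteness leaves finitely many such sets to intersect.\<close>
    moreover have "E ` F = E ` (\<lambda>f. restrict f (layer S l n)) ` F"
      unfolding image_image by (rule image_cong) (auto simp: E_def)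
    then have "finite (E ` F)" using fin by simp
    ultimately have "S \<inter> \<Inter>(E ` F) \<in> U n"
      by (intro ultrafilter_on_Inter[OF U]) auto
    then have "layer S l n \<inter> (S \<inter> \<Inter>(E ` F)) \<in> U n"
      by (rule ultrafilter_on_Int[OF U[OF order_refl] L[OF order_refl]])
    moreover have "{} \<notin> U n" using U[of n] by (simp add: ultrafilter_on_def)
    ultimately have "layer S l n \<inter> (S \<inter> \<Inter>(E ` F)) \<noteq> {}" by metis
    then obtain x where "x \<in> layer S l n" "\<forall>f\<in>F. x \<in> E f" by blast
    then show ?thesis by (auto simp: E_def)
  qed
  obtain x where x: "range x \<subseteq> layer S l n" and sums: "sums_along padd F x \<subseteq> Some ` T"
    by (rule sums_along_choice[OF ps FS _ fin ex]) (auto simp: layer_def)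
  \<comment> \<open>Each \<open>A' i\<close> lies in layer \<open>i\<close>, so a point of
    \<open>T\<close> in layer \<open>k\<close> comes from \<open>A' k\<close> and has its
    colour.\<close>
  have "c s = col k" if "s \<in> layer S l k" "Some s \<in> sums_along padd F x" for k s
    using sums that unfolding T_def A'_def A_def layer_def by auto
  moreover have "block_sequence padd F x"
    using sums unfolding block_sequence_def by blast
  ultimately show ?thesis using x by blast
qed

section \<open>Bounded-quantifier formulas\<close>

definition Imp :: "bfm \<Rightarrow> bfm \<Rightarrow> bfm" where "Imp \<phi> \<psi> = Neg (Conj \<phi> (Neg \<psi>))"
definition Iff :: "bfm \<Rightarrow> bfm \<Rightarrow> bfm" where "Iff \<phi> \<psi> = Conj (Imp \<phi> \<psi>) (Imp \<psi> \<phi>)"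
definition BAll :: "nat \<Rightarrow> nat \<Rightarrow> bfm \<Rightarrow> bfm" where "BAll i j \<phi> = Neg (BEx i j (Neg \<phi>))"

text \<open>The variables 20, 21 and 22 are reserved for bound variables.\<close>

definition Is_pair :: "nat \<Rightarrow> nat \<Rightarrow> nat \<Rightarrow> bfm" where
  "Is_pair i j k = Conj (IsSet k) (Conj (Mem i k) (Conj (Mem j k)
     (BAll 22 k (Imp (Neg (Eq 22 i)) (Eq 22 j)))))"

definition Is_opair :: "nat \<Rightarrow> nat \<Rightarrow> nat \<Rightarrow> bfm" where
  "Is_opair i j k = BEx 20 k (BEx 21 k
     (Conj (Is_pair i i 20) (Conj (Is_pair i j 21) (Is_pair 20 21 k))))"

lemma sat_derived [simp]:
  "sat is_set ext (Imp \<phi> \<psi>) e \<longleftrightarrow> (sat is_set ext \<phi> e \<longrightarrow> sat is_set ext \<psi> e)"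
  "sat is_set ext (Iff \<phi> \<psi>) e \<longleftrightarrow> (sat is_set ext \<phi> e \<longleftrightarrow> sat is_set ext \<psi> e)"
  "sat is_set ext (BAll i j \<phi>) e \<longleftrightarrow> (\<forall>u \<in> ext (e j). sat is_set ext \<phi> (e(i := u)))"
  by (auto simp: Imp_def Iff_def BAll_def)

context star_universe
begin

section \<open>Sets and ordered pairs of the universe, and iterated transfer\<close>

lemma set_of_props:
  assumes "small A"
  shows "is_set (set_of A)" "ext (set_of A) = A"
proof -
  have "\<exists>!a. is_set a \<and> ext a = A"
    using assms extensionality unfolding small_def by blast
  from theI'[OF this] show "is_set (set_of A)" "ext (set_of A) = A"
    unfolding set_of_def by auto
qed

lemma eq_set_of_iff: "small A \<Longrightarrow> a = set_of A \<longleftrightarrow> is_set a \<and> ext a = A"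
  using set_of_props extensionality by metis

lemma set_of_inject: "small A \<Longrightarrow> small B \<Longrightarrow> set_of A = set_of B \<longleftrightarrow> A = B"
  using set_of_props by metis

lemma small_singleton: "small {x}"
  using small_pair[of x x] by simp

lemma opair_inject [simp]: "opair x y = opair x' y' \<longleftrightarrow> x = x' \<and> y = y'"
  by (auto simp: opair_def set_of_inject small_pair small_singleton doubleton_eq_iff)

lemma sat_Is_pair:
  assumes "i \<noteq> 22" "j \<noteq> 22" "k \<noteq> 22"
  shows "sat is_set ext (Is_pair i j k) e \<longleftrightarrow> e k = set_of {e i, e j}"
  using assms by (auto simp: Is_pair_def eq_set_of_iff small_pair)

text \<open>Both components of a Kuratowski pair are its members, so bounded quantifiers reach them.
  The bounds on the indices prevent capture.\<close>

lemma sat_Is_opair [simp]: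
  assumes "i < 20" "j < 20" "k < 20"
  shows "sat is_set ext (Is_opair i j k) e \<longleftrightarrow> e k = opair (e i) (e j)"
  using assms
  by (auto simp: Is_opair_def sat_Is_pair opair_def set_of_props small_pair)

lemma transfer_pow:
  "sat is_set ext \<phi> (\<lambda>i. (star ^^ m) (e i)) \<longleftrightarrow> sat is_set ext \<phi> e"
proof (induction m)
  case (Suc m)
  then show ?case using transfer[of \<phi> "\<lambda>i. (star ^^ m) (e i)"] by simp
qed simp

section \<open>Stars of sets and of graphs\<close>

text \<open>The superset \<open>C\<close> lets one transferred formula give both closure under
  intersection and monotonicity.\<close>

lemma hyp_Int:
  assumes "small A" "small B" "small C" "A \<inter> B \<subseteq> C"
  shows "hyp m A \<inter> hyp m B \<subseteq> hyp m C"
  using transfer_pow[of "BAll 3 0 (Imp (Mem 3 1) (Mem 3 2))" m "\<lambda>i. [set_of A, set_of B, set_of C] ! i"]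
    assms by (auto simp: hyp_def set_of_props)

lemma hyp_mono: "small B \<Longrightarrow> A \<subseteq> B \<Longrightarrow> hyp m A \<subseteq> hyp m B"
  using hyp_Int[of A A B m] small_subset by blast

lemma hyp_Diff:
  assumes "small A" "B \<subseteq> A" "\<alpha> \<in> hyp m A"
  shows "\<alpha> \<in> hyp m (A - B) \<longleftrightarrow> \<alpha> \<notin> hyp m B"
  using transfer_pow[of "BAll 3 0 (Iff (Mem 3 1) (Neg (Mem 3 2)))" m
      "\<lambda>i. [set_of A, set_of (A - B), set_of B] ! i"]
    assms small_subset[of A "A - B"] small_subset[of A B]
  by (auto simp: hyp_def set_of_props)

lemma hyp_empty: "hyp m {} = {}"
proof -
  have "small {}" using small_subset[OF small_singleton] by blast
  then show ?thesis
    using hyp_mono[of "{}" "{}" m] hyp_Diff[of "{}" "{}" _ m] by auto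
qed

text \<open>One treatment for maps and for the partial operation: \<open>P\<close> is
  \<open>S\<close> or its set of pairs, and \<open>h\<close> is partial. Transfer gives that
  preimages commute with the star and that the starred graph is single-valued.\<close>

lemma hyp_graph:
  assumes small: "small P" "small B"
    and G: "G = {opair p z | p z. p \<in> P \<and> z \<in> B \<and> h p = Some z}"
    and g: "opair a \<gamma> \<in> hyp m G" and C: "C \<subseteq> B"
  shows "a \<in> hyp m {p \<in> P. \<exists>z\<in>C. h p = Some z} \<longleftrightarrow> \<gamma> \<in> hyp m C"
    and "opair a \<gamma>' \<in> hyp m G \<Longrightarrow> \<gamma>' = \<gamma>"
proof -
  let ?Q = "{p \<in> P. \<exists>z\<in>C. h p = Some z}"
  have sG: "small G" by (rule small_subset[OF small_times[OF small(1,2)]]) (auto simp: G)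
  have sQ: "small ?Q" by (rule small_subset[OF small(1)]) auto
  have sC: "small C" by (rule small_subset[OF small(2) C])
  have 1: "\<exists>p\<in>hyp m P. \<exists>z\<in>hyp m B. g = opair p z \<and> (p \<in> hyp m ?Q \<longleftrightarrow> z \<in> hyp m C)"
    if "g \<in> hyp m G" for g
  proof -
    have "\<forall>g\<in>G. \<exists>p\<in>P. \<exists>z\<in>B. g = opair p z \<and> (p \<in> ?Q \<longleftrightarrow> z \<in> C)"
      unfolding G by force
    then show ?thesis
      using transfer_pow[of "BAll 5 0 (BEx 6 1 (BEx 7 2 (Conj (Is_opair 6 7 5) (Iff (Mem 6 3) (Mem 7 4)))))"
          m "\<lambda>i. [set_of G, set_of P, set_of B, set_of ?Q, set_of C] ! i"] that
      by (simp add: hyp_def set_of_props small sG sQ sC)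
  qed
  show "a \<in> hyp m ?Q \<longleftrightarrow> \<gamma> \<in> hyp m C"
    using 1[OF g] by auto
  have 2: "\<forall>p\<in>hyp m P. \<forall>z\<in>hyp m B. \<forall>z'\<in>hyp m B.
      opair p z \<in> hyp m G \<longrightarrow> opair p z' \<in> hyp m G \<longrightarrow> z = z'"
  proof -
    have "\<forall>p\<in>P. \<forall>z\<in>B. \<forall>z'\<in>B. opair p z \<in> G \<longrightarrow> opair p z' \<in> G \<longrightarrow> z = z'"
      unfolding G by force
    \<comment> \<open>The formulas have no terms for pairs, so the two pairs become variables
      bounded by \<open>G\<close>.\<close>
    then have "\<forall>p\<in>P. \<forall>z\<in>B. \<forall>z'\<in>B. \<forall>g\<in>G. \<forall>g'\<in>G. g = opair p z \<longrightarrow> g' = opair p z' \<longrightarrow> z = z'"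
      by blast
    then show ?thesis
      using transfer_pow[of "BAll 5 1 (BAll 6 2 (BAll 7 2 (BAll 8 0 (BAll 9 0
           (Imp (Is_opair 5 6 8) (Imp (Is_opair 5 7 9) (Eq 6 7)))))))"
          m "\<lambda>i. [set_of G, set_of P, set_of B] ! i"]
      by (simp add: hyp_def set_of_props small sG)
  qed
  show "\<gamma>' = \<gamma>" if "opair a \<gamma>' \<in> hyp m G"
    using 1[OF g] 1[OF that] 2 g that by auto
qed

lemma hyp_graph_total:
  assumes "small A" "f \<in> A \<rightarrow> A" "a \<in> hyp m A"
  shows "\<exists>\<gamma>. opair a \<gamma> \<in> hyp m (fun_graph A f)"
proof -
  have "small (fun_graph A f)"
    by (rule small_subset[OF small_times[OF assms(1,1)]]) (use assms in \<open>auto simp: fun_graph_def\<close>)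
  then show ?thesis
    using transfer_pow[of "BAll 3 0 (BEx 4 0 (BEx 5 1 (Is_opair 3 4 5)))" m
        "\<lambda>i. [set_of A, set_of (fun_graph A f)] ! i"] assms
    by (fastforce simp: hyp_def set_of_props fun_graph_def)
qed

text \<open>As \<open>x\<close> is fixed by \<open>star\<close>, it survives transfer as a
  parameter: the star of a section of \<open>R\<close> is the section of its star.\<close>

lemma hyp_section:
  assumes "small A" "small R" "x \<in> A" "star x = x" "\<beta> \<in> hyp 1 A"
  shows "\<beta> \<in> hyp 1 {y \<in> A. opair x y \<in> R} \<longleftrightarrow> opair x \<beta> \<in> hyp 1 R"
proof -
  have "small {y \<in> A. opair x y \<in> R}" by (rule small_subset[OF assms(1)]) auto
  then show ?thesis
    using transfer_pow[of "BAll 4 0 (Iff (Mem 4 1) (BEx 5 2 (Is_opair 3 4 5)))" 1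
        "\<lambda>i. [set_of A, set_of {y \<in> A. opair x y \<in> R}, set_of R, x] ! i"] assms
    by (auto simp: hyp_def set_of_props)
qed

text \<open>The star map is applied to a formula whose parameters include the nonstandard objects
  \<open>\<beta>\<close> and \<open>star (set_of R)\<close>; this produces the twofold star of \<open>R\<close>.\<close>

lemma hyp_cosection:
  assumes "small A" "small R" "\<alpha> \<in> hyp 1 A"
  shows "\<alpha> \<in> hyp 1 {x \<in> A. opair x \<beta> \<in> hyp 1 R} \<longleftrightarrow> opair \<alpha> (star \<beta>) \<in> hyp 2 R"
proof -
  \<comment> \<open>The set is defined from nonstandard data, but as a subset of \<open>A\<close> it
    belongs to the universe and can be a parameter.\<close>
  have "small {x \<in> A. opair x \<beta> \<in> hyp 1 R}" by (rule small_subset[OF assms(1)]) auto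
  then show ?thesis
    using transfer_pow[of "BAll 4 0 (Iff (Mem 4 1) (BEx 5 2 (Is_opair 4 3 5)))" 1
        "\<lambda>i. [set_of A, set_of {x \<in> A. opair x \<beta> \<in> hyp 1 R}, star (set_of R), \<beta>] ! i"] assms
    by (auto simp: hyp_def set_of_props numeral_2_eq_2)
qed

end

section \<open>The ultrafilters of a Ramsey element\<close>

context nonstandard_universe
begin

lemma small_subset_S: "B \<subseteq> S \<Longrightarrow> small B"
  using small_S small_subset by blast

lemma ultrafilter_on_ufilter:
  assumes "\<alpha> \<in> hyp m S"
  shows "ultrafilter_on S (ufilter m \<alpha>)"
  unfolding ultrafilter_on_def ufilter_def
proof (intro conjI allI impI ballI)
  show "{} \<notin> {B. B \<subseteq> S \<and> \<alpha> \<in> hyp m B}"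
    by (simp add: hyp_empty)
next
  fix A assume "A \<subseteq> S"
  then show "A \<in> {B. B \<subseteq> S \<and> \<alpha> \<in> hyp m B} \<or> S - A \<in> {B. B \<subseteq> S \<and> \<alpha> \<in> hyp m B}"
    using hyp_Diff[OF small_S _ assms] by auto
next
  fix A B assume "A \<in> {B. B \<subseteq> S \<and> \<alpha> \<in> hyp m B}" "A \<subseteq> B \<and> B \<subseteq> S"
  then show "B \<in> {B. B \<subseteq> S \<and> \<alpha> \<in> hyp m B}"
    using hyp_mono[OF small_subset_S, of B A m] by auto
next
  fix A B assume "A \<in> {B. B \<subseteq> S \<and> \<alpha> \<in> hyp m B}" "B \<in> {B. B \<subseteq> S \<and> \<alpha> \<in> hyp m B}"
  then show "A \<inter> B \<in> {B. B \<subseteq> S \<and> \<alpha> \<in> hyp m B}"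
    using hyp_Int[of A B "A \<inter> B" m] small_subset_S[of A] small_subset_S[of B]
      small_subset_S[of "A \<inter> B"] by auto
qed

section \<open>Extended maps and sums in terms of ultrafilters\<close>

lemma hfun_preimage:
  assumes f: "f \<in> S \<rightarrow> S" and a: "\<alpha> \<in> hyp m S" and B: "B \<subseteq> S"
  shows "\<alpha> \<in> hyp m {s \<in> S. f s \<in> B} \<longleftrightarrow> hfun m f \<alpha> \<in> hyp m B"
proof -
  have G: "fun_graph S f = {opair p z | p z. p \<in> S \<and> z \<in> S \<and> Some (f p) = Some z}"
    using f by (auto simp: fun_graph_def)
  obtain \<gamma> where g: "opair \<alpha> \<gamma> \<in> hyp m (fun_graph S f)"
    using hyp_graph_total[OF small_S f a] by blast
  note graph = hyp_graph[OF small_S small_S G]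
  have "hfun m f \<alpha> = \<gamma>"
    unfolding hfun_def using g graph(2)[OF g order_refl] by blast
  then show ?thesis using graph(1)[OF g B] by simp
qed

lemma hplus_preimage:
  assumes "hplus m padd \<alpha> \<beta> = Some \<sigma>" and closed: "\<And>x y z. x \<in> S \<Longrightarrow> y \<in> S \<Longrightarrow> padd x y = Some z \<Longrightarrow> z \<in> S"
    and B: "B \<subseteq> S"
  shows "opair \<alpha> \<beta> \<in> hyp m {opair x y | x y. x \<in> S \<and> y \<in> S \<and> (\<exists>z\<in>B. padd x y = Some z)}
    \<longleftrightarrow> \<sigma> \<in> hyp m B"
proof -
  define P where "P = {opair x y | x y. x \<in> S \<and> y \<in> S}"
  \<comment> \<open>The operation becomes a partial function of one argument, the pair, so that
    \<open>hyp_graph\<close> applies.\<close>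
  define h where "h p = (THE r. \<exists>x y. p = opair x y \<and> r = padd x y)" for p
  have h: "h (opair x y) = padd x y" for x y unfolding h_def by auto
  have sP: "small P" unfolding P_def by (rule small_times[OF small_S small_S])
  have G: "op_graph S padd = {opair p z | p z. p \<in> P \<and> z \<in> S \<and> h p = Some z}"
  proof (intro equalityI subsetI)
    fix g assume "g \<in> op_graph S padd"
    then obtain x y z where g: "g = opair (opair x y) z" "x \<in> S" "y \<in> S" "padd x y = Some z"
      unfolding op_graph_def by blast
    then have "opair x y \<in> P" "z \<in> S" "h (opair x y) = Some z"
      using closed[OF g(2-4)] h by (auto simp: P_def)
    with g(1) show "g \<in> {opair p z | p z. p \<in> P \<and> z \<in> S \<and> h p = Some z}" by blast
  qed (auto simp: op_graph_def P_def h)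
  note graph = hyp_graph[OF sP small_S G]
  obtain \<gamma> where g: "opair (opair \<alpha> \<beta>) \<gamma> \<in> hyp m (op_graph S padd)"
    using assms(1) unfolding hplus_def by (auto split: if_splits)
  then have "\<sigma> = (THE \<gamma>. opair (opair \<alpha> \<beta>) \<gamma> \<in> hyp m (op_graph S padd))"
    using assms(1) unfolding hplus_def by (auto split: if_splits)
  also have "\<dots> = \<gamma>"
    using g graph(2)[OF g order_refl] by blast
  finally have "\<sigma> = \<gamma>" .
  moreover have "{p \<in> P. \<exists>z\<in>B. h p = Some z} =
      {opair x y | x y. x \<in> S \<and> y \<in> S \<and> (\<exists>z\<in>B. padd x y = Some z)}"
    using h by (auto simp: P_def)
  ultimately show ?thesis using graph(1)[OF g B] by simp
qed

text \<open>The ultrafilter of \<alpha> + *\<beta> is the convolution of those of \<alpha> and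
  \<beta>. \<open>hyp_section\<close> turns the inner membership into one in the star of
  \<open>R\<close>, and \<open>hyp_cosection\<close> turns the outer one into membership in its
  twofold star.\<close>

lemma hplus_star_preimage:
  assumes sum: "hplus 2 padd \<alpha> (star \<beta>) = Some \<sigma>" and ps: "partial_semigroup S padd"
    and a: "\<alpha> \<in> hyp 1 S" and b: "\<beta> \<in> hyp 1 S" and B: "B \<subseteq> S"
  shows "\<sigma> \<in> hyp 2 B \<longleftrightarrow> {x \<in> S. shift S padd x B \<in> ufilter 1 \<beta>} \<in> ufilter 1 \<alpha>"
proof -
  define R where "R = {opair x y | x y. x \<in> S \<and> y \<in> S \<and> (\<exists>z\<in>B. padd x y = Some z)}"
  have sR: "small R"
    unfolding R_def by (rule small_subset[OF small_times[OF small_S small_S]]) auto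
  have "shift S padd x B \<in> ufilter 1 \<beta> \<longleftrightarrow> opair x \<beta> \<in> hyp 1 R" if x: "x \<in> S" for x
  proof -
    have "shift S padd x B = {y \<in> S. opair x y \<in> R}"
      using x by (auto simp: shift_def R_def)
    then show ?thesis
      using hyp_section[OF small_S sR x star_S[OF x] b] by (auto simp: ufilter_def)
  qed
  then have "{x \<in> S. shift S padd x B \<in> ufilter 1 \<beta>} = {x \<in> S. opair x \<beta> \<in> hyp 1 R}"
    by blast
  moreover have "opair \<alpha> (star \<beta>) \<in> hyp 2 R \<longleftrightarrow> \<sigma> \<in> hyp 2 B"
    unfolding R_def by (rule hplus_preimage[OF sum partial_semigroup_closed[OF ps] B])
  ultimately show ?thesis
    using hyp_cosection[OF small_S sR a] by (auto simp: ufilter_def)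
qed

lemma Ramsey_monochromatic:
  fixes c :: "'v \<Rightarrow> 'c"
  assumes ls: "layered_semigroup S padd l \<delta>"
    and reg: "\<forall>f\<in>F. regressive S padd l f"
    and lf: "locally_finite_maps S l F"
    and ram: "Ramsey padd l \<delta> F"
    and n: "enat n < \<delta>"
    and c: "finite (c ` S)"
  shows "\<exists>x :: nat \<Rightarrow> 'v. range x \<subseteq> layer S l n \<and> block_sequence padd F x \<and>
           (\<forall>k\<le>n. \<exists>col. \<forall>s \<in> layer S l k. Some s \<in> sums_along padd F x \<longrightarrow> c s = col)"
proof -
  have ps: "partial_semigroup S padd" using ls unfolding layered_semigroup_def by blast
  obtain \<alpha> where prod: "\<alpha> \<in> layer_product padd l \<delta>" and ram: "Ramsey_element padd F \<delta> \<alpha>"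
    using ram unfolding Ramsey_def by blast
  have \<delta>: "enat k < \<delta>" if "k \<le> n" for k
    using that n by (meson enat_ord_simps(1) le_less_trans)
  have aL: "\<alpha> k \<in> hyp 1 (layer S l k)" if "k \<le> n" for k
    using prod \<delta>[OF that] by (auto simp: layer_product_def gamma_def PiE_def Pi_def)
  have layer_S: "layer S l k \<subseteq> S" for k unfolding layer_def by blast
  have aS: "\<alpha> k \<in> hyp 1 S" if "k \<le> n" for k
    using aL[OF that] hyp_mono[OF small_S layer_S] by blast
  have FS: "f \<in> S \<rightarrow> S" if "f \<in> F" for f using reg that unfolding regressive_def by blast
  have pre: "preceq padd (\<alpha> j) (\<alpha> i)" if "i \<le> j" "j \<le> n" for i j
    using ram that \<delta> unfolding Ramsey_element_def by blast
  \<comment> \<open>\<open>preceq\<close> controls the sums in both orders, so one comparison serves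
    \<open>i \<le> j\<close> and the opposite case.\<close>
  have sum: "\<exists>\<sigma>. hplus 2 padd (\<alpha> i) (star (\<alpha> j)) = Some \<sigma> \<and> ufilter 2 \<sigma> = ufilter 1 (\<alpha> (max i j))"
    if "i \<le> n" "j \<le> n" for i j
  proof (cases "i \<le> j")
    case True
    then show ?thesis using pre[OF True \<open>j \<le> n\<close>] by (auto simp: preceq_def u_equiv_def max_def)
  next
    case False
    then show ?thesis using pre[of j i] that by (auto simp: preceq_def u_equiv_def max_def)
  qed
  show ?thesis
  proof (rule ultrafilter_sums_monochromatic[where U = "\<lambda>k. ufilter 1 (\<alpha> k)", OF ps FS _ _ _ _ _ c])
    \<comment> \<open>Restriction to layer \<open>n\<close> factors through restriction to all
      layers up to \<open>n\<close>, where finiteness is assumed.\<close>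
    have "(\<lambda>f. restrict f (layer S l n)) ` F =
        (\<lambda>g. restrict g (layer S l n)) ` (\<lambda>f. restrict f (layers_upto S l n)) ` F"
      by (auto simp: image_image restrict_restrict layer_def layers_upto_def Int_def
          intro!: image_cong ext)
    then show "finite ((\<lambda>f. restrict f (layer S l n)) ` F)"
      using lf unfolding locally_finite_maps_def by simp
    show "ultrafilter_on S (ufilter 1 (\<alpha> k))" if "k \<le> n" for k
      by (rule ultrafilter_on_ufilter[OF aS[OF that]])
    show "layer S l k \<in> ufilter 1 (\<alpha> k)" if "k \<le> n" for k
      using aL[OF that] layer_S by (simp add: ufilter_def)
    show "{x \<in> S. shift S padd x B \<in> ufilter 1 (\<alpha> j)} \<in> ufilter 1 (\<alpha> i)"
      if "i \<le> n" "j \<le> n" "B \<subseteq> S" "B \<in> ufilter 1 (\<alpha> (max i j))" for i j B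
      using sum[OF that(1,2)] hplus_star_preimage[OF _ ps aS aS that(3)] that
      by (metis (no_types, lifting) mem_Collect_eq ufilter_def)
    show "\<exists>k\<le>n. \<forall>B\<in>ufilter 1 (\<alpha> k). B \<subseteq> S \<longrightarrow> {s \<in> S. f s \<in> B} \<in> ufilter 1 (\<alpha> n)"
      if f: "f \<in> F" for f
    proof -
      obtain k where "k \<le> n" "u_equiv 1 (hfun 1 f (\<alpha> n)) 1 (\<alpha> k)"
        using ram f n unfolding Ramsey_element_def coherent_def by blast
      then show ?thesis
        using hfun_preimage[OF FS[OF f] aS[OF order_refl]]
        by (intro exI[of _ k]) (auto simp: u_equiv_def ufilter_def set_eq_iff)
    qed
  qed
qed

end

theorem theorem5p3:
  fixes is_set :: "'v \<Rightarrow> bool" and ext :: "'v \<Rightarrow> 'v set" and star :: "'v \<Rightarrow> 'v"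
    and S :: "'v set" and padd :: "'v \<Rightarrow> 'v \<Rightarrow> 'v option" and l :: "'v \<Rightarrow> nat"
    and \<delta> :: enat and F :: "('v \<Rightarrow> 'v) set" and n :: nat and c :: "'v \<Rightarrow> 'c"
  assumes "nonstandard_universe is_set ext star S"
    and "layered_semigroup S padd l \<delta>"
    and "adequate S padd l"
    and "\<forall>f\<in>F. regressive S padd l f"
    and "locally_finite_maps S l F"
    and "nonstandard_universe.Ramsey is_set ext star S padd l \<delta> F"
    and "enat n < \<delta>"
    and "finite (c ` S)"
  shows "\<exists>x :: nat \<Rightarrow> 'v. range x \<subseteq> layer S l n \<and> block_sequence padd F x \<and>
           (\<forall>k\<le>n. \<exists>col. \<forall>s \<in> layer S l k. Some s \<in> sums_along padd F x \<longrightarrow> c s = col)"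
  using nonstandard_universe.Ramsey_monochromatic[OF assms(1,2,4,5,6,7,8)] .

end
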